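(* Let $\mathfrak{E}$ be a Banach space with a normalized, $1$-unconditional basis $(e_n)_{n=1}^\infty$ and summable Szlenk index. Then for every sequence $(X_n)_{n=1}^\infty$ of finite-dimensional Banach spaces the space $X=\left(\bigoplus_{n=1}^\infty X_n\right)_{\mathfrak{E}}$ has summable Szlenk index.
   Context: For a Banach space $X$, a weak$^*$-compact set $K\subset X^*$ and $\varepsilon>0$, put $\iota_\varepsilon K=\{x^*\in K:\ \mathrm{diam}(K\cap U)>\varepsilon$ for every weak$^*$-open neighborhood $U$ of $x^*\}$ (norm diameter). $X$ has summable Szlenk index if there is a constant $M$ such that for all $n\in\mathbb{N}$ and all positive $\varepsilon_1,\ldots,\varepsilon_n$ with $\iota_{\varepsilon_1}\cdots\iota_{\varepsilon_n}B_{X^*}\neq\varnothing$ one has $\sum_{i=1}^n\varepsilon_i\leq M$, where $B_{X^*}$ is the closed unit ball of $X^*$. $(\bigoplus_{n=1}^\infty X_n)_{\mathfrak{E}}$ is the Banach space of all sequences $(x_n)\in\prod_nX_n$ for which $\sum_n\|x_n\|e_n$ converges in $\mathfrak{E}$, with coordinatewise operations and norm $\|(x_n)\|=\bigl\|\sum_n\|x_n\|e_n\bigr\|$. *)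

theory Defs
  imports "HOL-Analysis.Analysis" "HOL-Library.Function_Algebras"
begin

text \<open>
  All scalars are real.  Since the summands of a direct sum have no common type, a normed space is
  given by a carrier \<open>V\<close>, a subspace of an ambient real vector space, together with a function
  \<open>N\<close> which is a norm on \<open>V\<close>; values of \<open>N\<close> outside \<open>V\<close> are irrelevant.  A type
  of class \<open>banach\<close> is the pair \<open>(UNIV, norm)\<close>.
\<close>

instantiation "fun" :: (type, real_vector) real_vector
begin

definition scaleR_fun :: "real \<Rightarrow> ('a \<Rightarrow> 'b) \<Rightarrow> 'a \<Rightarrow> 'b"
  where "scaleR_fun c f = (\<lambda>i. c *\<^sub>R f i)"

instance
  by standard (auto simp: scaleR_fun_def fun_eq_iff scaleR_add_right scaleR_add_left)

end

definition normed_space_on :: "'v::real_vector set \<Rightarrow> ('v \<Rightarrow> real) \<Rightarrow> bool"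
  where "normed_space_on V N \<longleftrightarrow>
    subspace V \<and>
    (\<forall>x\<in>V. 0 \<le> N x \<and> (N x = 0 \<longleftrightarrow> x = 0)) \<and>
    (\<forall>c. \<forall>x\<in>V. N (c *\<^sub>R x) = \<bar>c\<bar> * N x) \<and>
    (\<forall>x\<in>V. \<forall>y\<in>V. N (x + y) \<le> N x + N y)"

definition banach_space_on :: "'v::real_vector set \<Rightarrow> ('v \<Rightarrow> real) \<Rightarrow> bool"
  where "banach_space_on V N \<longleftrightarrow>
    normed_space_on V N \<and> Metric_space.mcomplete V (\<lambda>x y. N (x - y))"

definition finite_dimensional :: "'v::real_vector set \<Rightarrow> bool"
  where "finite_dimensional V \<longleftrightarrow> (\<exists>B. finite B \<and> span B = V)"


subsection \<open>Dual space and weak* topology\<close>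

text \<open>
  A functional on \<open>V\<close> is represented by its extensional (\<open>undefined\<close> outside \<open>V\<close>)
  function, so that distinct representatives are distinct functionals.
\<close>

definition dual_space :: "'v::real_vector set \<Rightarrow> ('v \<Rightarrow> real) \<Rightarrow> ('v \<Rightarrow> real) set"
  where "dual_space V N = {f \<in> extensional V.
    (\<forall>x\<in>V. \<forall>y\<in>V. f (x + y) = f x + f y) \<and>
    (\<forall>c. \<forall>x\<in>V. f (c *\<^sub>R x) = c * f x) \<and>
    (\<exists>C. \<forall>x\<in>V. \<bar>f x\<bar> \<le> C * N x)}"

definition dual_norm :: "'v set \<Rightarrow> ('v \<Rightarrow> real) \<Rightarrow> ('v \<Rightarrow> real) \<Rightarrow> real"
  where "dual_norm V N f = (SUP x\<in>{x\<in>V. N x \<le> 1}. \<bar>f x\<bar>)"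

definition dual_ball :: "'v::real_vector set \<Rightarrow> ('v \<Rightarrow> real) \<Rightarrow> ('v \<Rightarrow> real) set"
  where "dual_ball V N = {f \<in> dual_space V N. dual_norm V N f \<le> 1}"

definition weak_star_topology :: "'v::real_vector set \<Rightarrow> ('v \<Rightarrow> real) \<Rightarrow> ('v \<Rightarrow> real) topology"
  where "weak_star_topology V N =
    subtopology (product_topology (\<lambda>_. euclideanreal) V) (dual_space V N)"

text \<open>
  As for the library's \<open>diameter\<close>, only meaningful for norm-bounded sets.  The pointwise
  difference need not be extensional, but \<open>dual_norm\<close> only looks at its values on \<open>V\<close>.
\<close>

definition dual_diameter :: "'v set \<Rightarrow> ('v \<Rightarrow> real) \<Rightarrow> ('v \<Rightarrow> real) set \<Rightarrow> real"
  where "dual_diameter V N A =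
    (if A = {} then 0 else SUP (f,g)\<in>A\<times>A. dual_norm V N (\<lambda>x. f x - g x))"


subsection \<open>Summable Szlenk index\<close>

definition szlenk_derivative ::
    "'v::real_vector set \<Rightarrow> ('v \<Rightarrow> real) \<Rightarrow> real \<Rightarrow> ('v \<Rightarrow> real) set \<Rightarrow> ('v \<Rightarrow> real) set"
  where "szlenk_derivative V N \<epsilon> K = {f \<in> K. \<forall>U. openin (weak_star_topology V N) U \<and> f \<in> U \<longrightarrow>
    dual_diameter V N (K \<inter> U) > \<epsilon>}"

text \<open>\<open>foldr\<close> applies the derivative for the last entry of the list first.\<close>

definition summable_szlenk :: "'v::real_vector set \<Rightarrow> ('v \<Rightarrow> real) \<Rightarrow> bool"
  where "summable_szlenk V N \<longleftrightarrow>
    (\<exists>M. \<forall>\<epsilon>s. (\<forall>\<epsilon>\<in>set \<epsilon>s. 0 < \<epsilon>) \<and> foldr (szlenk_derivative V N) \<epsilon>s (dual_ball V N) \<noteq> {} \<longrightarrow>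
      sum_list \<epsilon>s \<le> M)"


subsection \<open>Unconditional bases and direct sums\<close>

definition schauder_basis :: "(nat \<Rightarrow> 'e::real_normed_vector) \<Rightarrow> bool"
  where "schauder_basis e \<longleftrightarrow> (\<forall>x. \<exists>!a::nat \<Rightarrow> real. (\<lambda>n. a n *\<^sub>R e n) sums x)"

text \<open>
  A Schauder basis satisfying the inequality below for some \<open>K\<close> is an unconditional basis, and
  the least such \<open>K\<close> is its unconditional basis constant.
\<close>

definition unconditional_basis :: "real \<Rightarrow> (nat \<Rightarrow> 'e::real_normed_vector) \<Rightarrow> bool"
  where "unconditional_basis K e \<longleftrightarrow> schauder_basis e \<and>
    (\<forall>n. \<forall>a b::nat \<Rightarrow> real. (\<forall>i<n. \<bar>a i\<bar> \<le> \<bar>b i\<bar>) \<longrightarrow>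
      norm (\<Sum>i<n. a i *\<^sub>R e i) \<le> K * norm (\<Sum>i<n. b i *\<^sub>R e i))"

definition direct_sum ::
    "(nat \<Rightarrow> 'e::real_normed_vector) \<Rightarrow> (nat \<Rightarrow> 'v set) \<Rightarrow> (nat \<Rightarrow> 'v \<Rightarrow> real) \<Rightarrow> (nat \<Rightarrow> 'v) set"
  where "direct_sum e V N = {x. (\<forall>n. x n \<in> V n) \<and> summable (\<lambda>n. N n (x n) *\<^sub>R e n)}"

definition direct_sum_norm ::
    "(nat \<Rightarrow> 'e::real_normed_vector) \<Rightarrow> (nat \<Rightarrow> 'v \<Rightarrow> real) \<Rightarrow> (nat \<Rightarrow> 'v) \<Rightarrow> real"
  where "direct_sum_norm e N x = norm (\<Sum>n. N n (x n) *\<^sub>R e n)"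


subsection \<open>Agreement with the library on types\<close>

lemma dual_space_UNIV: "dual_space UNIV norm = range (blinfun_apply :: ('e::real_normed_vector \<Rightarrow>\<^sub>L real) \<Rightarrow> _)"
proof -
  have "f \<in> dual_space UNIV norm \<longleftrightarrow> bounded_linear f" for f :: "'e \<Rightarrow> real"
    unfolding dual_space_def bounded_linear_def bounded_linear_axioms_def linear_iff
    by (auto simp: mult.commute)
  moreover have "bounded_linear f \<longleftrightarrow> f \<in> range blinfun_apply" for f :: "'e \<Rightarrow> real"
    using bounded_linear_Blinfun_apply[of f] blinfun.bounded_linear_right by (metis rangeE rangeI)
  ultimately show ?thesis by blast
qed

lemma dual_norm_UNIV: "dual_norm UNIV norm (blinfun_apply f) = norm f"
  for f :: "'e::real_normed_vector \<Rightarrow>\<^sub>L real"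
proof -
  have bdd: "bdd_above ((\<lambda>x. \<bar>blinfun_apply f x\<bar>) ` {x. norm x \<le> 1})"
  proof (intro bdd_aboveI2)
    fix x :: 'e assume "x \<in> {x. norm x \<le> 1}"
    then show "\<bar>blinfun_apply f x\<bar> \<le> norm f"
      using norm_blinfun[of f x] mult_left_le[of "norm x" "norm f"] by auto
  qed
  let ?S = "SUP x\<in>{x. norm x \<le> 1}. \<bar>blinfun_apply f x\<bar>"
  have "?S \<le> norm f"
  proof (rule cSUP_least)
    show "{x::'e. norm x \<le> 1} \<noteq> {}" by (auto intro: exI[of _ 0])
    fix x :: 'e assume "x \<in> {x. norm x \<le> 1}"
    then show "\<bar>blinfun_apply f x\<bar> \<le> norm f"
      using norm_blinfun[of f x] mult_left_le[of "norm x" "norm f"] by auto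
  qed
  moreover have S0: "0 \<le> ?S"
    using cSUP_upper[OF _ bdd, of 0] by auto
  moreover have "norm f \<le> ?S"
  proof (rule norm_blinfun_bound[OF S0])
    fix x :: 'e
    show "norm (blinfun_apply f x) \<le> ?S * norm x"
    proof (cases "x = 0")
      case False
      then have "\<bar>blinfun_apply f (x /\<^sub>R norm x)\<bar> \<le> ?S"
        by (intro cSUP_upper[OF _ bdd]) auto
      with False show ?thesis
        by (simp add: blinfun.scaleR_right abs_mult field_simps)
    qed auto
  qed
  ultimately show ?thesis by (simp add: dual_norm_def)
qed

lemma weak_star_topology_UNIV:
  "strong_operator_topology = pullback_topology UNIV blinfun_apply (weak_star_topology UNIV norm)"
proof -
  have "(\<exists>W. open W \<and> U = blinfun_apply -` W) \<longleftrightarrow>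
      (\<exists>W. (\<exists>T. open T \<and> W = T \<inter> range blinfun_apply) \<and> U = blinfun_apply -` W)"
    for U :: "('e::real_normed_vector \<Rightarrow>\<^sub>L real) set"
    by (auto simp: vimage_Int)
  then show ?thesis
    unfolding strong_operator_topology_def weak_star_topology_def dual_space_UNIV topology_eq
      euclidean_product_topology openin_pullback_topology openin_subtopology open_openin[symmetric]
    by auto
qed

end

theory Submission
  imports Defs
begin

text \<open>
  A functional \<open>f\<close> in the unit ball of \<open>X\<^sup>*\<close> is sent to the functional on \<open>E\<close> whose \<open>n\<close>-th coefficient
  is the norm of the restriction of \<open>f\<close> to \<open>X\<^sub>n\<close>. As the \<open>X\<^sub>n\<close> are finite-dimensional, this map is
  weak*-to-weak* continuous on the unit ball. Summability of the Szlenk index forces the basis of \<open>E\<close> to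
  be shrinking, so a functional weak* close to \<open>f\<close> differs from \<open>f\<close> in norm essentially only on a tail
  on which \<open>f\<close> itself is negligible; there the map almost preserves distances. Since a set of diameter above
  \<open>\<epsilon>\<close> has points at distance above \<open>\<epsilon>/2\<close> from any given point, the map carries \<open>\<iota>\<^sub>\<epsilon>\<close>-derivatives into
  \<open>\<iota>\<^bsub>\<epsilon>/3\<^esub>\<close>-derivatives, and the constant \<open>M\<close> for \<open>E\<close> yields \<open>3M\<close> for \<open>X\<close>.
\<close>

section \<open>Coefficients in finite-dimensional spaces\<close>

text \<open>By compactness \<open>N (L u)\<close> attains its minimum on the l1 sphere of
  coefficients; linear independence makes this minimum positive, and its reciprocal serves as
  \<open>C\<close>. The bound later turns closeness on the finitely many vectors of \<open>B\<close>
  into closeness in the dual norm.\<close>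

lemma finite_dimensional_coefficient_bound:
  fixes V :: "'v::real_vector set"
  assumes V: "normed_space_on V N" and fin: "finite_dimensional V"
  obtains B C where "finite B" "B \<subseteq> V" "0 < C"
    "\<And>x. x \<in> V \<Longrightarrow> \<exists>u. x = (\<Sum>b\<in>B. u b *\<^sub>R b) \<and> (\<Sum>b\<in>B. \<bar>u b\<bar>) \<le> C * N x"
proof -
  obtain B0 where B0: "finite B0" "span B0 = V"
    using fin by (auto simp: finite_dimensional_def)
  obtain B where B: "B \<subseteq> B0" "independent B" "B0 \<subseteq> span B"
    using maximal_independent_subset[of B0] by blast
  have finB: "finite B" using B(1) B0(1) finite_subset by blast
  have spanB: "span B = V"
    using B B0(2) by (metis span_mono span_span subset_antisym)
  then have BV: "B \<subseteq> V" using span_superset by blast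
  have subV: "subspace V" and N_nonneg: "\<And>x. x \<in> V \<Longrightarrow> 0 \<le> N x"
    and N_eq_0: "\<And>x. x \<in> V \<Longrightarrow> N x = 0 \<longleftrightarrow> x = 0"
    and N_scale: "\<And>c x. x \<in> V \<Longrightarrow> N (c *\<^sub>R x) = \<bar>c\<bar> * N x"
    and N_add: "\<And>x y. x \<in> V \<Longrightarrow> y \<in> V \<Longrightarrow> N (x + y) \<le> N x + N y"
    using V unfolding normed_space_on_def by auto
  define L where "L u = (\<Sum>b\<in>B. u b *\<^sub>R b)" for u :: "'v \<Rightarrow> real"
  have LV: "L u \<in> V" for u
    unfolding L_def using subV BV by (intro subspace_sum) (auto intro: subspace_scale)
  have N_L: "N (L u) \<le> (\<Sum>b\<in>B. \<bar>u b\<bar> * N b)" for u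
  proof -
    have "N (\<Sum>b\<in>A. u b *\<^sub>R b) \<le> (\<Sum>b\<in>A. \<bar>u b\<bar> * N b)" if "finite A" "A \<subseteq> V" for A
      using that
    proof (induction A)
      case empty
      then show ?case using N_eq_0[of 0] subspace_0[OF subV] by simp
    next
      case (insert b A)
      have "(\<Sum>b\<in>A. u b *\<^sub>R b) \<in> V" "u b *\<^sub>R b \<in> V"
        using insert subV by (auto intro!: subspace_sum intro: subspace_scale)
      then have "N (u b *\<^sub>R b + (\<Sum>b\<in>A. u b *\<^sub>R b)) \<le> \<bar>u b\<bar> * N b + N (\<Sum>b\<in>A. u b *\<^sub>R b)"
        using N_add N_scale[of b "u b"] insert.prems by fastforce
      then show ?case using insert by auto
    qed
    then show ?thesis using finB BV by (simp add: L_def)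
  qed
  have N_L_diff: "\<bar>N (L u) - N (L v)\<bar> \<le> (\<Sum>b\<in>B. \<bar>u b - v b\<bar> * N b)" for u v
  proof -
    have one: "N (L u) - N (L v) \<le> (\<Sum>b\<in>B. \<bar>u b - v b\<bar> * N b)" for u v
    proof -
      have "L u = L v + L (\<lambda>b. u b - v b)"
        by (simp add: L_def sum.distrib[symmetric] scaleR_left_diff_distrib)
      then show ?thesis using N_add[OF LV LV, of v "\<lambda>b. u b - v b"] N_L[of "\<lambda>b. u b - v b"] by simp
    qed
    show ?thesis using one[of u v] one[of v u] by (simp add: abs_minus_commute abs_le_iff)
  qed
  show thesis
  proof (cases "B = {}")
    \<comment> \<open>The l1 sphere would be empty here and have no minimum; \<open>V\<close> is the
      zero space and any constant works.\<close>
    case True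
    then show thesis using spanB N_eq_0[of 0] by (intro that[of B 1]) auto
  next
    case False
    \<comment> \<open>Coefficients are functions on the whole type; pinning them to 0 outside
      \<open>B\<close> makes \<open>T\<close> a product of compact sets, hence compact in the
      product topology.\<close>
    define T where "T = (\<Pi>\<^sub>E b\<in>UNIV. if b \<in> B then {-1..1::real} else {0})"
    have "compactin (product_topology (\<lambda>_. euclidean) UNIV) T"
      unfolding T_def by (subst compactin_PiE) auto
    then have "compact T"
      by (simp add: euclidean_product_topology)
    have cont_coord: "continuous_on A (\<lambda>u::'v \<Rightarrow> real. u b)" for A b
      by (rule continuous_on_product_then_coordinatewise[OF continuous_on_id])
    define S where "S = T \<inter> {u. (\<Sum>b\<in>B. \<bar>u b\<bar>) = 1}"
    have "closed {u. (\<Sum>b\<in>B. \<bar>u b\<bar>) = (1::real)}"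
      by (intro closed_Collect_eq continuous_intros cont_coord)
    then have "compact S"
      unfolding S_def by (rule compact_Int_closed[OF \<open>compact T\<close>])
    moreover have "S \<noteq> {}"
    proof -
      obtain b where b: "b \<in> B" using False by blast
      have "(\<Sum>b'\<in>B. \<bar>if b' = b then 1 else 0 :: real\<bar>) = (\<Sum>b'\<in>B. if b' = b then 1 else 0)"
        by (rule sum.cong) auto
      then have "(\<lambda>b'. if b' = b then 1 else 0) \<in> S"
        using b finB by (auto simp: S_def T_def)
      then show ?thesis by blast
    qed
    moreover have "continuous_on S (\<lambda>u. N (L u))"
      unfolding continuous_on_def
    proof
      fix u assume "u \<in> S"
      have "((\<lambda>v. v b) \<longlongrightarrow> u b) (at u within S)" for b
        using cont_coord[of S b] \<open>u \<in> S\<close> by (simp add: continuous_on_def)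
      then have "((\<lambda>v. \<Sum>b\<in>B. \<bar>v b - u b\<bar> * N b) \<longlongrightarrow> (\<Sum>b\<in>B. \<bar>u b - u b\<bar> * N b)) (at u within S)"
        by (intro tendsto_intros)
      then have "((\<lambda>v. \<Sum>b\<in>B. \<bar>v b - u b\<bar> * N b) \<longlongrightarrow> 0) (at u within S)"
        by simp
      then have "((\<lambda>v. N (L v) - N (L u)) \<longlongrightarrow> 0) (at u within S)"
        by (rule Lim_null_comparison[rotated]) (simp add: N_L_diff)
      then show "((\<lambda>v. N (L v)) \<longlongrightarrow> N (L u)) (at u within S)"
        by (rule LIM_zero_cancel)
    qed
    ultimately obtain u0 where u0: "u0 \<in> S" "\<And>u. u \<in> S \<Longrightarrow> N (L u0) \<le> N (L u)"
      using continuous_attains_inf by meson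
    have "L u0 \<noteq> 0"
    proof
      assume "L u0 = 0"
      then have "u0 b = 0" if "b \<in> B" for b
        using independentD[of B B u0 b] B(2) finB that by (simp add: L_def)
      then show False using u0(1) by (simp add: S_def)
    qed
    then have pos: "0 < N (L u0)"
      using N_nonneg[OF LV] N_eq_0[OF LV] by (metis order_le_less)
    show thesis
    proof (rule that[of B "1 / N (L u0)"])
      fix x assume "x \<in> V"
      then obtain u where u: "x = L u"
        using spanB span_finite[OF finB] by (auto simp: L_def)
      define s where "s = (\<Sum>b\<in>B. \<bar>u b\<bar>)"
      have "s * N (L u0) \<le> N x"
      proof (cases "s = 0")
        case True
        then show ?thesis using N_nonneg \<open>x \<in> V\<close> by simp
      next
        case False
        then have s: "0 < s" unfolding s_def by (simp add: order_less_le sum_nonneg)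
        \<comment> \<open>The coefficients of \<open>x\<close> rescaled to the l1 sphere; the value
          0 outside \<open>B\<close> keeps \<open>w\<close> in \<open>T\<close>.\<close>
        define w where "w b = (if b \<in> B then u b / s else 0)" for b
        have "\<bar>u b\<bar> \<le> s" if "b \<in> B" for b
          unfolding s_def using finB that member_le_sum[of b B "\<lambda>b. \<bar>u b\<bar>"] by simp
        then have "w \<in> T"
          using s by (force simp: T_def w_def divide_le_eq le_divide_eq abs_le_iff)
        moreover have "(\<Sum>b\<in>B. \<bar>w b\<bar>) = 1"
          using s by (simp add: w_def sum_divide_distrib[symmetric] s_def[symmetric])
        ultimately have "N (L u0) \<le> N (L w)" by (intro u0) (simp add: S_def)
        also have "L w = (1 / s) *\<^sub>R x"
          by (simp add: u L_def w_def scaleR_sum_right)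
        finally show ?thesis using s N_scale[OF \<open>x \<in> V\<close>, of "1 / s"] by (simp add: field_simps)
      qed
      then show "\<exists>u. x = (\<Sum>b\<in>B. u b *\<^sub>R b) \<and> (\<Sum>b\<in>B. \<bar>u b\<bar>) \<le> 1 / N (L u0) * N x"
        using u pos by (intro exI[of _ u]) (simp add: L_def s_def field_simps)
    qed (use finB BV pos in auto)
  qed
qed

section \<open>Dual balls and Szlenk derivatives\<close>

text \<open>Test the supremum in \<open>dual_norm\<close> on \<open>x\<close> divided by
  \<open>N x\<close>. The constant from \<open>dual_space\<close> shows that the supremum is over a
  bounded set, and it settles the case \<open>N x = 0\<close>. Working from homogeneity and
  nonnegativity of \<open>N\<close> lets the lemma serve both \<open>norm\<close> and direct sum
  norms.\<close>

lemma dual_ball_abs_le: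
  assumes f: "f \<in> dual_ball V N" and x: "x \<in> V"
    and scale: "\<And>c x. x \<in> V \<Longrightarrow> c *\<^sub>R x \<in> V" "\<And>c x. x \<in> V \<Longrightarrow> N (c *\<^sub>R x) = \<bar>c\<bar> * N x"
    and nonneg: "\<And>x. x \<in> V \<Longrightarrow> 0 \<le> N x"
  shows "\<bar>f x\<bar> \<le> N x"
proof -
  from f have "\<exists>C. \<forall>x\<in>V. \<bar>f x\<bar> \<le> C * N x" and hom: "\<And>c. f (c *\<^sub>R x) = c * f x"
    using x by (simp_all add: dual_ball_def dual_space_def)
  then obtain C where C: "\<And>x. x \<in> V \<Longrightarrow> \<bar>f x\<bar> \<le> C * N x"
    by blast
  show ?thesis
  proof (cases "N x = 0")
    case True
    then show ?thesis using C[OF x] by simp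
  next
    case False
    then have pos: "0 < N x" using nonneg[OF x] by simp
    have "bdd_above ((\<lambda>x. \<bar>f x\<bar>) ` {x \<in> V. N x \<le> 1})"
    proof (intro bdd_aboveI2)
      fix y assume "y \<in> {x \<in> V. N x \<le> 1}"
      then have y: "y \<in> V" "N y \<le> 1" by auto
      have "\<bar>f y\<bar> \<le> C * N y" using C y by simp
      also have "\<dots> \<le> \<bar>C\<bar> * N y" using nonneg[OF y(1)] by (intro mult_right_mono) auto
      also have "\<dots> \<le> \<bar>C\<bar> * 1" using y by (intro mult_left_mono) auto
      finally show "\<bar>f y\<bar> \<le> \<bar>C\<bar>" by simp
    qed
    then have "\<bar>f ((1 / N x) *\<^sub>R x)\<bar> \<le> dual_norm V N f"
      unfolding dual_norm_def using scale x pos by (intro cSUP_upper) auto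
    also have "\<dots> \<le> 1" using f by (simp add: dual_ball_def)
    finally show ?thesis using pos by (simp add: hom field_simps abs_mult)
  qed
qed

lemma foldr_szlenk_derivative_subset: "foldr (szlenk_derivative V N) \<epsilon>s K \<subseteq> K"
proof (induction \<epsilon>s)
  case (Cons \<epsilon> \<epsilon>s)
  have "szlenk_derivative V N \<epsilon> L \<subseteq> L" for L
    unfolding szlenk_derivative_def by blast
  then show ?case using Cons by (metis foldr_Cons comp_apply subset_trans)
qed simp

text \<open>If all of \<open>K \<inter> U\<close> stayed within \<open>\<epsilon> / 2\<close> of
  \<open>f\<close> on the unit ball, the triangle inequality through \<open>f\<close> would bound
  the diameter by \<open>\<epsilon>\<close>. The assumption \<open>zero\<close> keeps the supremum
  in \<open>dual_norm\<close> over a nonempty set.\<close>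

lemma szlenk_derivative_far_point:
  assumes f: "f \<in> szlenk_derivative V N \<epsilon> K" and "0 \<le> \<epsilon>"
    and U: "openin (weak_star_topology V N) U" "f \<in> U"
    and zero: "\<exists>x\<in>V. N x \<le> 1"
  obtains g x where "g \<in> K \<inter> U" "x \<in> V" "N x \<le> 1" "\<epsilon> / 2 < \<bar>g x - f x\<bar>"
proof -
  have diam: "\<epsilon> < dual_diameter V N (K \<inter> U)" and ne: "K \<inter> U \<noteq> {}"
    using f U by (auto simp: szlenk_derivative_def)
  have "\<exists>g\<in>K \<inter> U. \<exists>x\<in>{x \<in> V. N x \<le> 1}. \<epsilon> / 2 < \<bar>g x - f x\<bar>"
  proof (rule ccontr)
    assume "\<not> ?thesis"
    then have near: "\<bar>g x - f x\<bar> \<le> \<epsilon> / 2" if "g \<in> K \<inter> U" "x \<in> {x \<in> V. N x \<le> 1}" for g x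
      using that by (meson not_le)
    have "dual_norm V N (\<lambda>x. g x - h x) \<le> \<epsilon>" if "g \<in> K \<inter> U" "h \<in> K \<inter> U" for g h
      unfolding dual_norm_def
    proof (rule cSUP_least)
      fix x assume "x \<in> {x \<in> V. N x \<le> 1}"
      then show "\<bar>g x - h x\<bar> \<le> \<epsilon>"
        using near[OF that(1), of x] near[OF that(2), of x] by linarith
    qed (use zero in auto)
    then have "dual_diameter V N (K \<inter> U) \<le> \<epsilon>"
      unfolding dual_diameter_def if_not_P[OF ne] using ne by (intro cSUP_least) auto
    then show False using diam by simp
  qed
  then show thesis using that by blast
qed

lemma dual_ball_UNIV_abs_le:
  fixes \<phi> :: "'e::real_normed_vector \<Rightarrow> real"
  assumes "\<phi> \<in> dual_ball UNIV norm"
  shows "\<bar>\<phi> x\<bar> \<le> norm x"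
  using dual_ball_abs_le[OF assms, of x] by simp

lemma dual_ball_UNIV_linear:
  fixes \<phi> :: "'e::real_normed_vector \<Rightarrow> real"
  assumes "\<phi> \<in> dual_ball UNIV norm"
  shows "linear \<phi>"
  using assms by (intro linearI) (auto simp: dual_ball_def dual_space_def)

text \<open>A single pair and a single vector witness a large diameter once both nested suprema are
  known to be over bounded sets; inside the dual ball 2 is a common bound.\<close>

lemma dual_diameter_UNIV_greater:
  fixes A :: "('e::real_normed_vector \<Rightarrow> real) set"
  assumes A: "A \<subseteq> dual_ball UNIV norm" "\<phi> \<in> A" "\<psi> \<in> A"
    and y: "norm y \<le> 1" "\<epsilon> < \<bar>\<phi> y - \<psi> y\<bar>"
  shows "\<epsilon> < dual_diameter UNIV norm A"
proof -
  have bound: "\<bar>\<phi> x - \<psi> x\<bar> \<le> 2" if "\<phi> \<in> A" "\<psi> \<in> A" "norm x \<le> 1" for \<phi> \<psi> and x :: 'e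
    using dual_ball_UNIV_abs_le[of \<phi> x] dual_ball_UNIV_abs_le[of \<psi> x] A(1) that by fastforce
  have "\<epsilon> < \<bar>\<phi> y - \<psi> y\<bar>" by fact
  also have "\<dots> \<le> dual_norm UNIV norm (\<lambda>x. \<phi> x - \<psi> x)"
    unfolding dual_norm_def using y(1) bound[OF A(2,3)]
    by (intro cSUP_upper bdd_aboveI2[where M = 2]) auto
  also have "\<dots> \<le> (SUP (\<phi>, \<psi>)\<in>A \<times> A. dual_norm UNIV norm (\<lambda>x. \<phi> x - \<psi> x))"
  proof -
    have "bdd_above ((\<lambda>(\<phi>, \<psi>). dual_norm UNIV norm (\<lambda>x. \<phi> x - \<psi> x)) ` (A \<times> A))"
    proof (intro bdd_aboveI2[where M = 2], clarify)
      fix \<phi> \<psi> assume "\<phi> \<in> A" "\<psi> \<in> A"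
      then show "dual_norm UNIV norm (\<lambda>x. \<phi> x - \<psi> x) \<le> 2"
        unfolding dual_norm_def using bound
        by (intro cSUP_least) (auto intro: exI[of _ 0])
    qed
    then show ?thesis
      using A(2,3) cSUP_upper[of "(\<phi>, \<psi>)" "A \<times> A" "\<lambda>(\<phi>, \<psi>). dual_norm UNIV norm (\<lambda>x. \<phi> x - \<psi> x)"]
      by simp
  qed
  also have "\<dots> = dual_diameter UNIV norm A"
    using A(2) by (auto simp: dual_diameter_def)
  finally show ?thesis .
qed


section \<open>Functionals on a space with a 1-unconditional basis\<close>

locale one_unconditional_basis =
  fixes e :: "nat \<Rightarrow> 'e::banach"
  assumes basis: "unconditional_basis 1 e"
begin

lemma expansion: "\<exists>!a. (\<lambda>n. a n *\<^sub>R e n) sums x"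
  using basis unfolding unconditional_basis_def schauder_basis_def by blast

lemma norm_sum_mono:
  assumes "\<And>i. i < n \<Longrightarrow> \<bar>a i\<bar> \<le> \<bar>b i\<bar>"
  shows "norm (\<Sum>i<n. a i *\<^sub>R e i) \<le> norm (\<Sum>i<n. b i *\<^sub>R e i)"
proof -
  have "norm (\<Sum>i<n. a i *\<^sub>R e i) \<le> 1 * norm (\<Sum>i<n. b i *\<^sub>R e i)"
    using basis assms unfolding unconditional_basis_def by blast
  then show ?thesis by simp
qed

text \<open>Unconditionality compares initial sums; padding with zeros makes it apply to the blocks
  in the Cauchy criterion.\<close>

lemma sum_from: "(\<Sum>i=m..<n. a i *\<^sub>R e i) = (\<Sum>i<n. (if m \<le> i then a i else 0) *\<^sub>R e i)"
  by (rule sum.mono_neutral_cong_left) auto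

lemma summable_mono:
  assumes sb: "summable (\<lambda>i. b i *\<^sub>R e i)" and ab: "\<And>i. \<bar>a i\<bar> \<le> \<bar>b i\<bar>"
  shows "summable (\<lambda>i. a i *\<^sub>R e i)"
  unfolding summable_Cauchy
proof (intro allI impI)
  fix r :: real assume "0 < r"
  then obtain M where M: "\<And>m n. M \<le> m \<Longrightarrow> norm (\<Sum>i=m..<n. b i *\<^sub>R e i) < r"
    using sb unfolding summable_Cauchy by blast
  have "norm (\<Sum>i=m..<n. a i *\<^sub>R e i) \<le> norm (\<Sum>i=m..<n. b i *\<^sub>R e i)" for m n
    unfolding sum_from using ab by (intro norm_sum_mono) auto
  then show "\<exists>M. \<forall>m\<ge>M. \<forall>n. norm (\<Sum>i=m..<n. a i *\<^sub>R e i) < r"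
    using M by (meson order_le_less_trans)
qed

lemma norm_suminf_mono:
  assumes sb: "summable (\<lambda>i. b i *\<^sub>R e i)" and ab: "\<And>i. \<bar>a i\<bar> \<le> \<bar>b i\<bar>"
  shows "norm (\<Sum>i. a i *\<^sub>R e i) \<le> norm (\<Sum>i. b i *\<^sub>R e i)"
proof (rule LIMSEQ_le)
  show "(\<lambda>n. norm (\<Sum>i<n. a i *\<^sub>R e i)) \<longlonglongrightarrow> norm (\<Sum>i. a i *\<^sub>R e i)"
    by (intro tendsto_norm summable_LIMSEQ summable_mono[OF assms])
  show "(\<lambda>n. norm (\<Sum>i<n. b i *\<^sub>R e i)) \<longlonglongrightarrow> norm (\<Sum>i. b i *\<^sub>R e i)"
    by (intro tendsto_norm summable_LIMSEQ sb)
  show "\<exists>N. \<forall>n\<ge>N. norm (\<Sum>i<n. a i *\<^sub>R e i) \<le> norm (\<Sum>i<n. b i *\<^sub>R e i)"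
    using ab by (auto intro!: norm_sum_mono)
qed

lemma sums_finite_support: "(\<lambda>i. (if i < n then a i else 0) *\<^sub>R e i) sums (\<Sum>i<n. a i *\<^sub>R e i)"
proof -
  have "(\<lambda>i. (if i < n then a i else 0) *\<^sub>R e i) = (\<lambda>i. if i \<in> {..<n} then a i *\<^sub>R e i else 0)"
    by auto
  then show ?thesis
    using sums_If_finite_set[of "{..<n}" "\<lambda>i. a i *\<^sub>R e i"] by simp
qed

lemma norm_sum_le_suminf:
  assumes "summable (\<lambda>i. b i *\<^sub>R e i)"
  shows "norm (\<Sum>i<n. b i *\<^sub>R e i) \<le> norm (\<Sum>i. b i *\<^sub>R e i)"
  using norm_suminf_mono[OF assms, of "\<lambda>i. if i < n then b i else 0"]
    sums_unique[OF sums_finite_support[of n b]] by simp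

section \<open>Functionals given by their coefficients\<close>

text \<open>The biorthogonal functionals of the basis, well defined by uniqueness in
  \<open>expansion\<close>.\<close>

definition coord :: "'e \<Rightarrow> nat \<Rightarrow> real"
  where "coord x = (THE a. (\<lambda>n. a n *\<^sub>R e n) sums x)"

lemma coord_sums: "(\<lambda>n. coord x n *\<^sub>R e n) sums x"
  unfolding coord_def by (rule theI'[OF expansion])

lemma coord_eqI: "(\<lambda>n. a n *\<^sub>R e n) sums x \<Longrightarrow> coord x = a"
  unfolding coord_def by (rule the1_equality[OF expansion])

lemma coord_add: "coord (x + y) n = coord x n + coord y n"
  using fun_cong[OF coord_eqI[of "\<lambda>n. coord x n + coord y n" "x + y"], of n]
    sums_add[OF coord_sums[of x] coord_sums[of y]] by (simp add: scaleR_add_left)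

lemma coord_scaleR: "coord (c *\<^sub>R x) n = c * coord x n"
  using fun_cong[OF coord_eqI[of "\<lambda>n. c * coord x n" "c *\<^sub>R x"], of n]
    sums_scaleR_right[OF coord_sums[of x], of c] by simp

lemma coord_sum: "coord (\<Sum>i<k. c i *\<^sub>R e i) n = (if n < k then c n else 0)"
  using fun_cong[OF coord_eqI[OF sums_finite_support[of k c]], of n] .

text \<open>By 1-unconditionality signs are immaterial, so this describes the coefficient sequences
  of functionals of norm at most 1, tested on finite sums.\<close>

definition admissible :: "(nat \<Rightarrow> real) \<Rightarrow> bool"
  where "admissible a \<longleftrightarrow> (\<forall>m c. (\<Sum>n<m. \<bar>a n\<bar> * \<bar>c n\<bar>) \<le> norm (\<Sum>n<m. c n *\<^sub>R e n))"

definition functional :: "(nat \<Rightarrow> real) \<Rightarrow> 'e \<Rightarrow> real"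
  where "functional a x = (\<Sum>n. a n * coord x n)"

lemma admissible_mono:
  assumes "admissible b" "\<And>n. \<bar>a n\<bar> \<le> \<bar>b n\<bar>"
  shows "admissible a"
  unfolding admissible_def
proof (intro allI)
  fix m and c :: "nat \<Rightarrow> real"
  have "(\<Sum>n<m. \<bar>a n\<bar> * \<bar>c n\<bar>) \<le> (\<Sum>n<m. \<bar>b n\<bar> * \<bar>c n\<bar>)"
    using assms(2) by (intro sum_mono mult_right_mono) auto
  also have "\<dots> \<le> norm (\<Sum>n<m. c n *\<^sub>R e n)" using assms(1) by (simp add: admissible_def)
  finally show "(\<Sum>n<m. \<bar>a n\<bar> * \<bar>c n\<bar>) \<le> norm (\<Sum>n<m. c n *\<^sub>R e n)" .
qed

lemma functional_sum: "functional a (\<Sum>i<k. c i *\<^sub>R e i) = (\<Sum>i<k. a i * c i)"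
proof -
  have "functional a (\<Sum>i<k. c i *\<^sub>R e i) = (\<Sum>n. if n \<in> {..<k} then a n * c n else 0)"
    unfolding functional_def by (intro suminf_cong) (simp add: coord_sum)
  also have "\<dots> = (\<Sum>i<k. a i * c i)"
    using sums_unique[OF sums_If_finite_set[of "{..<k}" "\<lambda>n. a n * c n"]] by simp
  finally show ?thesis .
qed

lemma functional_basis: "functional a (e n) = a n"
proof -
  have "(\<Sum>i<Suc n. (if i = n then 1 else 0) *\<^sub>R e i) = e n"
    by (simp add: sum.neutral)
  moreover have "(\<Sum>i<Suc n. a i * (if i = n then 1 else 0)) = a n"
    by (simp add: sum.neutral)
  ultimately show ?thesis
    using functional_sum[of a "\<lambda>i. if i = n then 1 else 0" "Suc n"] by simp
qed

text \<open>Admissibility and monotonicity of the norm bound all partial sums of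
  \<open>\<bar>a n * coord x n\<bar>\<close> by \<open>norm x\<close>; absolute convergence then
  gives linearity and the norm bound together.\<close>

lemma functional_dual_ball:
  assumes a: "admissible a"
  shows "functional a \<in> dual_ball UNIV norm"
proof -
  have partial: "(\<Sum>n<m. \<bar>a n * coord x n\<bar>) \<le> norm x" for m x
  proof -
    have "(\<Sum>n<m. \<bar>a n * coord x n\<bar>) \<le> norm (\<Sum>n<m. coord x n *\<^sub>R e n)"
      using a by (simp add: admissible_def abs_mult)
    also have "\<dots> \<le> norm (\<Sum>n. coord x n *\<^sub>R e n)"
      by (rule norm_sum_le_suminf) (rule sums_summable[OF coord_sums])
    finally show ?thesis by (simp add: sums_unique[OF coord_sums, symmetric])
  qed
  have abs_sum: "summable (\<lambda>n. \<bar>a n * coord x n\<bar>)" for x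
    by (rule summableI_nonneg_bounded[OF _ partial]) simp
  have summ: "summable (\<lambda>n. a n * coord x n)" for x
    using abs_sum by (rule summable_rabs_cancel)
  have bound: "\<bar>functional a x\<bar> \<le> norm x" for x
  proof -
    have "\<bar>functional a x\<bar> \<le> (\<Sum>n. \<bar>a n * coord x n\<bar>)"
      unfolding functional_def using abs_sum by (rule summable_rabs)
    also have "\<dots> \<le> norm x" using abs_sum partial by (rule suminf_le_const)
    finally show ?thesis .
  qed
  have "functional a (x + y) = functional a x + functional a y" for x y
    unfolding functional_def using suminf_add[OF summ[of x] summ[of y]]
    by (simp add: coord_add distrib_left)
  moreover have "functional a (c *\<^sub>R x) = c * functional a x" for c x
    unfolding functional_def using suminf_mult[OF summ[of x], of c]
    by (simp add: coord_scaleR mult.left_commute)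
  moreover have "dual_norm UNIV norm (functional a) \<le> 1"
    unfolding dual_norm_def using bound
    by (intro cSUP_least) (auto intro: order_trans exI[of _ 0])
  ultimately show ?thesis
    using bound by (auto simp: dual_ball_def dual_space_def intro: exI[of _ 1])
qed

text \<open>On the unit ball, weak* convergence is convergence on the basis vectors, as these span a dense
  subspace.\<close>

lemma dual_ball_tendsto:
  assumes \<psi>: "\<And>m. \<psi> m \<in> dual_ball UNIV norm" and \<phi>: "\<phi> \<in> dual_ball UNIV norm"
    and lim: "\<And>n. (\<lambda>m. \<psi> m (e n)) \<longlonglongrightarrow> \<phi> (e n)"
  shows "(\<lambda>m. \<psi> m x) \<longlonglongrightarrow> \<phi> x"
proof (rule tendstoI)
  fix r :: real assume r: "0 < r"
  define S where "S k = (\<Sum>n<k. coord x n *\<^sub>R e n)" for k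
  have "S \<longlonglongrightarrow> x" unfolding S_def using coord_sums by (simp add: sums_def)
  then obtain k where k: "norm (S k - x) < r / 4"
    using r by (metis LIMSEQ_D order_refl zero_less_divide_iff zero_less_numeral)
  have lin: "\<theta> (S k) = (\<Sum>n<k. coord x n * \<theta> (e n))" if "\<theta> \<in> dual_ball UNIV norm" for \<theta>
    unfolding S_def using dual_ball_UNIV_linear[OF that] by (simp add: linear_sum linear_scale)
  \<comment> \<open>Every functional in the ball is 1-Lipschitz, so one \<open>k\<close> serves
    \<open>\<phi>\<close> and all \<open>\<psi> m\<close> at once; the total error is below
    \<open>r / 4 + r / 2 + r / 4\<close>.\<close>
  have close: "\<bar>\<theta> (S k) - \<theta> x\<bar> < r / 4" if "\<theta> \<in> dual_ball UNIV norm" for \<theta>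
    using dual_ball_UNIV_abs_le[OF that, of "S k - x"] dual_ball_UNIV_linear[OF that] k
    by (simp add: linear_diff)
  have "(\<lambda>m. \<psi> m (S k)) \<longlonglongrightarrow> \<phi> (S k)"
    unfolding lin[OF \<psi>] lin[OF \<phi>] by (intro tendsto_intros lim)
  then have "\<forall>\<^sub>F m in sequentially. dist (\<psi> m (S k)) (\<phi> (S k)) < r / 2"
    using r by (intro tendstoD) auto
  then show "\<forall>\<^sub>F m in sequentially. dist (\<psi> m x) (\<phi> x) < r"
  proof eventually_elim
    case (elim m)
    then show ?case using close[OF \<psi>[of m]] close[OF \<phi>] unfolding dist_real_def by linarith
  qed
qed

text \<open>It is enough to test \<open>\<eta> = 1 / (m + 1)\<close> for each \<open>m\<close>. If
  all of these failed, the counterexamples would form a sequence in the ball outside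
  \<open>W\<close> converging to \<open>\<phi>\<close> on every basis vector, hence weak*, which is
  impossible.\<close>

lemma weak_star_neighbourhood:
  assumes W: "openin (weak_star_topology UNIV norm) W" "\<phi> \<in> W" and \<phi>: "\<phi> \<in> dual_ball UNIV norm"
  shows "\<exists>m \<eta>. 0 < \<eta> \<and>
    (\<forall>\<psi>\<in>dual_ball UNIV norm. (\<forall>n<m. \<bar>\<psi> (e n) - \<phi> (e n)\<bar> \<le> \<eta>) \<longrightarrow> \<psi> \<in> W)"
proof (rule ccontr)
  assume neg: "\<not> ?thesis"
  have "\<exists>\<psi>. \<psi> \<in> dual_ball UNIV norm \<and> (\<forall>n<m. \<bar>\<psi> (e n) - \<phi> (e n)\<bar> \<le> inverse (real (Suc m))) \<and> \<psi> \<notin> W" for m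
    using neg by (metis inverse_positive_iff_positive of_nat_0_less_iff zero_less_Suc)
  then obtain \<psi> where \<psi>: "\<And>m. \<psi> m \<in> dual_ball UNIV norm"
    "\<And>m n. n < m \<Longrightarrow> \<bar>\<psi> m (e n) - \<phi> (e n)\<bar> \<le> inverse (real (Suc m))" "\<And>m. \<psi> m \<notin> W"
    by metis
  have "(\<lambda>m. \<psi> m (e n)) \<longlonglongrightarrow> \<phi> (e n)" for n
  proof -
    have "\<forall>\<^sub>F m in sequentially. norm (\<psi> m (e n) - \<phi> (e n)) \<le> inverse (real (Suc m))"
      using eventually_gt_at_top[of n] by eventually_elim (simp add: \<psi>(2) del: of_nat_Suc)
    then have "(\<lambda>m. \<psi> m (e n) - \<phi> (e n)) \<longlonglongrightarrow> 0"
      by (rule Lim_null_comparison) (rule LIMSEQ_inverse_real_of_nat)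
    then show ?thesis by (rule LIM_zero_cancel)
  qed
  then have lim: "(\<lambda>m. \<psi> m x) \<longlonglongrightarrow> \<phi> x" for x
    by (rule dual_ball_tendsto[OF \<psi>(1) \<phi>])
  have "limitin (product_topology (\<lambda>_. euclideanreal) UNIV) \<psi> \<phi> sequentially"
    using lim by (simp add: limitin_componentwise)
  then have "limitin (weak_star_topology UNIV norm) \<psi> \<phi> sequentially"
    unfolding weak_star_topology_def limitin_subtopology using \<psi>(1) \<phi> by (auto simp: dual_ball_def)
  then have "\<forall>\<^sub>F m in sequentially. \<psi> m \<in> W"
    using W by (auto simp: limitin_def)
  then show False using \<psi>(3) by (simp add: eventually_sequentially)
qed

text \<open>Weak* neighbourhoods are replaced by closeness of finitely many coefficients. Two nearby
  witnesses \<open>\<psi>\<close> and \<open>\<theta>\<close> are allowed, neither of which has to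
  be \<open>\<phi>\<close>.\<close>

lemma szlenk_derivativeI:
  assumes K: "K \<subseteq> dual_ball UNIV norm" and \<phi>: "\<phi> \<in> K"
    and far: "\<And>m \<eta>. 0 < \<eta> \<Longrightarrow> \<exists>\<psi>\<in>K. \<exists>\<theta>\<in>K. \<exists>y.
      (\<forall>n<m. \<bar>\<psi> (e n) - \<phi> (e n)\<bar> \<le> \<eta>) \<and> (\<forall>n<m. \<bar>\<theta> (e n) - \<phi> (e n)\<bar> \<le> \<eta>) \<and>
      norm y \<le> 1 \<and> \<epsilon> < \<bar>\<psi> y - \<theta> y\<bar>"
  shows "\<phi> \<in> szlenk_derivative UNIV norm \<epsilon> K"
  unfolding szlenk_derivative_def
proof (safe intro!: \<phi>)
  fix W assume W: "openin (weak_star_topology UNIV norm) W" "\<phi> \<in> W"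
  have "\<phi> \<in> dual_ball UNIV norm" using K \<phi> by blast
  then obtain m \<eta> where \<eta>: "0 < \<eta>"
    and m: "\<And>\<psi>. \<psi> \<in> dual_ball UNIV norm \<Longrightarrow> (\<forall>n<m. \<bar>\<psi> (e n) - \<phi> (e n)\<bar> \<le> \<eta>) \<Longrightarrow> \<psi> \<in> W"
    using weak_star_neighbourhood[OF W] by blast
  obtain \<psi> \<theta> y where "\<psi> \<in> K" "\<theta> \<in> K" "\<forall>n<m. \<bar>\<psi> (e n) - \<phi> (e n)\<bar> \<le> \<eta>"
    "\<forall>n<m. \<bar>\<theta> (e n) - \<phi> (e n)\<bar> \<le> \<eta>" "norm y \<le> 1" "\<epsilon> < \<bar>\<psi> y - \<theta> y\<bar>"
    using far[OF \<eta>, of m] by blast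
  then show "\<epsilon> < dual_diameter UNIV norm (K \<inter> W)"
    using K m by (intro dual_diameter_UNIV_greater[of _ \<psi> \<theta> y]) auto
qed

text \<open>The basis is shrinking: if the tails of an admissible \<open>a\<close> had norm above \<open>\<delta>\<close>, the restrictions of
  \<open>a\<close> to all sets of indices would survive arbitrarily many derivatives \<open>\<iota>\<^sub>\<delta>\<close>.\<close>

lemma admissible_tail:
  assumes sz: "summable_szlenk (UNIV :: 'e set) norm" and a: "admissible a" and \<delta>: "0 < \<delta>"
  shows "\<exists>m. \<forall>k c. (\<Sum>n=m..<k. \<bar>a n\<bar> * \<bar>c n\<bar>) \<le> \<delta> * norm (\<Sum>n<k. c n *\<^sub>R e n)"
proof (rule ccontr)
  assume neg: "\<not> ?thesis"
  \<comment> \<open>Letting \<open>S\<close> range over all index sets makes the family closed under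
    changes on a tail, which is why it lies in its own derivative.\<close>
  define R where "R S = functional (\<lambda>n. if n \<in> S then \<bar>a n\<bar> else 0)" for S
  have R_ball: "R S \<in> dual_ball UNIV norm" for S
    unfolding R_def by (intro functional_dual_ball admissible_mono[OF a]) auto
  have step: "R S \<in> szlenk_derivative UNIV norm \<delta> K" if K: "range R \<subseteq> K" "K \<subseteq> dual_ball UNIV norm" for S K
  proof (rule szlenk_derivativeI)
    fix m and \<eta> :: real assume \<eta>: "0 < \<eta>"
    obtain k c where kc: "\<delta> * norm (\<Sum>n<k. c n *\<^sub>R e n) < (\<Sum>n=m..<k. \<bar>a n\<bar> * \<bar>c n\<bar>)"
      using neg by (meson not_le)
    \<comment> \<open>Passing to absolute values and dropping the entries before \<open>m\<close>
      does not increase the norm, and the pairing with the tail of \<open>\<bar>a\<bar>\<close> is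
      unchanged.\<close>
    define d where "d n = (if m \<le> n then \<bar>c n\<bar> else 0)" for n
    define y where "y = (\<Sum>n<k. d n *\<^sub>R e n)"
    \<comment> \<open>Both sets agree with \<open>S\<close> below \<open>m\<close>, so the
      functionals share these coefficients with \<open>R S\<close>; they differ from each other by
      the entire tail of \<open>\<bar>a\<bar>\<close>.\<close>
    define S1 where "S1 = S \<union> {m..}"
    define S2 where "S2 = S \<inter> {..<m}"
    have "norm y \<le> norm (\<Sum>n<k. c n *\<^sub>R e n)"
      unfolding y_def by (intro norm_sum_mono) (simp add: d_def)
    then have "\<delta> * norm y < (\<Sum>n=m..<k. \<bar>a n\<bar> * \<bar>c n\<bar>)"
      using kc \<delta> by (meson mult_left_mono order_le_less_trans less_imp_le)
    also have "\<dots> = (\<Sum>n<k. (if m \<le> n then \<bar>a n\<bar> else 0) * d n)"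
      by (rule sum.mono_neutral_cong_left) (auto simp: d_def)
    also have "\<dots> = R S1 y - R S2 y"
      unfolding y_def R_def functional_sum sum_subtractf[symmetric]
      by (rule sum.cong) (auto simp: S1_def S2_def d_def)
    finally have less: "\<delta> * norm y < R S1 y - R S2 y" .
    have lin: "linear (R S)" for S by (rule dual_ball_UNIV_linear[OF R_ball])
    have "y \<noteq> 0" using less lin by (auto simp: linear_0)
    then have "\<delta> < (R S1 y - R S2 y) / norm y" using less by (simp add: field_simps)
    also have "\<dots> = R S1 (y /\<^sub>R norm y) - R S2 (y /\<^sub>R norm y)"
      using lin by (simp add: linear_scale divide_inverse algebra_simps)
    finally have "\<delta> < \<bar>R S1 (y /\<^sub>R norm y) - R S2 (y /\<^sub>R norm y)\<bar>" by simp
    moreover have "\<bar>R T (e n) - R S (e n)\<bar> \<le> \<eta>" if "T \<in> {S1, S2}" "n < m" for T n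
      using that \<eta> by (auto simp: R_def functional_basis S1_def S2_def)
    moreover have "R S1 \<in> K" "R S2 \<in> K" using K(1) by auto
    moreover have "norm (y /\<^sub>R norm y) \<le> 1" using \<open>y \<noteq> 0\<close> by simp
    ultimately show "\<exists>\<psi>\<in>K. \<exists>\<theta>\<in>K. \<exists>y.
      (\<forall>n<m. \<bar>\<psi> (e n) - R S (e n)\<bar> \<le> \<eta>) \<and> (\<forall>n<m. \<bar>\<theta> (e n) - R S (e n)\<bar> \<le> \<eta>) \<and>
      norm y \<le> 1 \<and> \<delta> < \<bar>\<psi> y - \<theta> y\<bar>"
      by blast
  qed (use K in auto)
  have survive: "range R \<subseteq> foldr (szlenk_derivative UNIV norm) (replicate n \<delta>) (dual_ball UNIV norm)" for n
  proof (induction n)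
    case 0
    then show ?case using R_ball by auto
  next
    case (Suc n)
    then show ?case
      using step[OF Suc foldr_szlenk_derivative_subset] by auto
  qed
  obtain M where M: "\<And>\<epsilon>s. (\<forall>\<epsilon>\<in>set \<epsilon>s. 0 < \<epsilon>) \<Longrightarrow>
      foldr (szlenk_derivative UNIV norm) \<epsilon>s (dual_ball (UNIV :: 'e set) norm) \<noteq> {} \<Longrightarrow> sum_list \<epsilon>s \<le> M"
    using sz unfolding summable_szlenk_def by blast
  \<comment> \<open>The list consisting of \<open>n\<close> copies of \<open>\<delta>\<close> leaves
    a nonempty derivative for every \<open>n\<close>, so its sum is bounded independently of
    \<open>n\<close>.\<close>
  have "real n * \<delta> \<le> M" for n
    using M[of "replicate n \<delta>"] survive[of n] \<delta> by (auto simp: sum_list_replicate)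
  then show False
    using reals_Archimedean3[OF \<delta>] by (meson not_le)
qed

end


section \<open>Direct sums\<close>

locale finite_dimensional_direct_sum = one_unconditional_basis e
  for e :: "nat \<Rightarrow> 'e::banach" +
  fixes V :: "nat \<Rightarrow> 'v::real_vector set" and N :: "nat \<Rightarrow> 'v \<Rightarrow> real"
  assumes norm_e: "norm (e n) = 1"
    and normed: "normed_space_on (V n) (N n)"
    and findim: "finite_dimensional (V n)"
begin

abbreviation "X \<equiv> direct_sum e V N"
abbreviation "normX \<equiv> direct_sum_norm e N"

lemma
  shows V_0: "0 \<in> V n"
    and V_scale: "v \<in> V n \<Longrightarrow> c *\<^sub>R v \<in> V n"
    and N_nonneg: "v \<in> V n \<Longrightarrow> 0 \<le> N n v"
    and N_eq_0: "v \<in> V n \<Longrightarrow> N n v = 0 \<longleftrightarrow> v = 0"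
    and N_scale: "v \<in> V n \<Longrightarrow> N n (c *\<^sub>R v) = \<bar>c\<bar> * N n v"
  using normed[of n] unfolding normed_space_on_def subspace_def by auto

lemma N_0: "N n 0 = 0"
  using N_eq_0[OF V_0] by simp

lemma V_sum: "(\<And>b. b \<in> B \<Longrightarrow> b \<in> V n) \<Longrightarrow> (\<Sum>b\<in>B. u b *\<^sub>R b) \<in> V n"
  using normed[of n] unfolding normed_space_on_def by (auto intro!: subspace_sum subspace_scale)

section \<open>Summands and truncations\<close>

definition single :: "nat \<Rightarrow> 'v \<Rightarrow> nat \<Rightarrow> 'v"
  where "single n v = (\<lambda>k. if k = n then v else 0)"

definition truncate :: "nat \<Rightarrow> (nat \<Rightarrow> 'v) \<Rightarrow> nat \<Rightarrow> 'v"
  where "truncate k x = (\<lambda>n. if n < k then x n else 0)"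

lemma direct_sum_scaleR: "x \<in> X \<Longrightarrow> c *\<^sub>R x \<in> X"
  and direct_sum_norm_scaleR: "x \<in> X \<Longrightarrow> normX (c *\<^sub>R x) = \<bar>c\<bar> * normX x"
proof -
  assume x: "x \<in> X"
  have eq: "N n ((c *\<^sub>R x) n) *\<^sub>R e n = \<bar>c\<bar> *\<^sub>R (N n (x n) *\<^sub>R e n)" for n
    using x by (simp add: scaleR_fun_def N_scale direct_sum_def)
  have sx: "summable (\<lambda>n. N n (x n) *\<^sub>R e n)" using x by (simp add: direct_sum_def)
  show "c *\<^sub>R x \<in> X"
    using x summable_scaleR_right[OF sx, of "\<bar>c\<bar>"] unfolding direct_sum_def mem_Collect_eq eq
    by (simp add: scaleR_fun_def V_scale)
  show "normX (c *\<^sub>R x) = \<bar>c\<bar> * normX x"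
    unfolding direct_sum_norm_def eq suminf_scaleR_right[OF sx, symmetric] by simp
qed

lemma dual_ball_le_norm: "f \<in> dual_ball X normX \<Longrightarrow> x \<in> X \<Longrightarrow> \<bar>f x\<bar> \<le> normX x"
  by (rule dual_ball_abs_le[of f X normX])
    (simp_all add: direct_sum_scaleR direct_sum_norm_scaleR, simp add: direct_sum_norm_def)

lemma dual_ball_add: "f \<in> dual_ball X normX \<Longrightarrow> x \<in> X \<Longrightarrow> y \<in> X \<Longrightarrow> f (x + y) = f x + f y"
  and dual_ball_scaleR: "f \<in> dual_ball X normX \<Longrightarrow> x \<in> X \<Longrightarrow> f (c *\<^sub>R x) = c * f x"
  by (auto simp: dual_ball_def dual_space_def)

lemma truncate_sums:
  "(\<lambda>n. N n (truncate k x n) *\<^sub>R e n) sums (\<Sum>n<k. N n (x n) *\<^sub>R e n)"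
proof -
  have "(\<lambda>n. N n (truncate k x n) *\<^sub>R e n) = (\<lambda>n. (if n < k then N n (x n) else 0) *\<^sub>R e n)"
    by (auto simp: truncate_def N_0)
  then show ?thesis using sums_finite_support[of k "\<lambda>n. N n (x n)"] by simp
qed

lemma truncate_in: "(\<And>n. x n \<in> V n) \<Longrightarrow> truncate k x \<in> X"
  using sums_summable[OF truncate_sums] by (auto simp: direct_sum_def truncate_def V_0)

lemma norm_truncate: "normX (truncate k x) = norm (\<Sum>n<k. N n (x n) *\<^sub>R e n)"
  by (simp add: direct_sum_norm_def sums_unique[OF truncate_sums, symmetric])

lemma single_eq_truncate: "single n v = truncate (Suc n) (single n v)"
  by (auto simp: single_def truncate_def)

lemma single_in: "v \<in> V n \<Longrightarrow> single n v \<in> X"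
  by (subst single_eq_truncate, rule truncate_in) (auto simp: single_def V_0)

lemma norm_single: "v \<in> V n \<Longrightarrow> normX (single n v) = N n v"
proof -
  assume v: "v \<in> V n"
  have "(\<Sum>k<Suc n. N k (single n v k) *\<^sub>R e k) = N n v *\<^sub>R e n"
    by (simp add: single_def N_0)
  then show ?thesis
    using norm_truncate[of "Suc n" "single n v"] v
    by (simp add: single_eq_truncate[symmetric] norm_e N_nonneg)
qed

lemma single_add: "single n (v + w) = single n v + single n w"
  by (auto simp: single_def)

lemma single_scaleR: "single n (c *\<^sub>R v) = c *\<^sub>R single n v"
  by (auto simp: single_def scaleR_fun_def)

lemma dual_ball_truncate:
  assumes f: "f \<in> dual_ball X normX" and x: "\<And>n. x n \<in> V n"
  shows "f (truncate k x) = (\<Sum>n<k. f (single n (x n)))"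
proof (induction k)
  case 0
  \<comment> \<open>The empty truncation is the zero vector; writing it as 0 times itself reduces
    the claim to homogeneity of \<open>f\<close>.\<close>
  have "f (0 *\<^sub>R truncate 0 x) = 0 * f (truncate 0 x)"
    by (rule dual_ball_scaleR[OF f truncate_in[OF x]])
  moreover have "0 *\<^sub>R truncate 0 x = truncate 0 x"
    by (auto simp: truncate_def scaleR_fun_def)
  ultimately show ?case by (simp only: mult_zero_left lessThan_0 sum.empty)
next
  case (Suc k)
  have "truncate (Suc k) x = truncate k x + single k (x k)"
    by (auto simp: truncate_def single_def)
  then have "f (truncate (Suc k) x) = f (truncate k x) + f (single k (x k))"
    using dual_ball_add[OF f truncate_in[OF x] single_in[OF x], of k k] by metis
  then show ?case using Suc by simp
qed

text \<open>The remainder \<open>r k\<close> lies in \<open>X\<close> and its norm is that of a tail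
  of a convergent series, so \<open>f\<close> tends to 0 along it.\<close>

lemma dual_ball_truncate_tendsto:
  assumes f: "f \<in> dual_ball X normX" and x: "x \<in> X"
  shows "(\<lambda>k. f (truncate k x)) \<longlonglongrightarrow> f x"
proof -
  have xV: "\<And>n. x n \<in> V n" and sx: "summable (\<lambda>n. N n (x n) *\<^sub>R e n)"
    using x by (auto simp: direct_sum_def)
  define r where "r k = (\<lambda>n. if n < k then 0 else x n)" for k
  have r_sums: "(\<lambda>n. N n (r k n) *\<^sub>R e n) sums
      ((\<Sum>n. N n (x n) *\<^sub>R e n) - (\<Sum>n<k. N n (x n) *\<^sub>R e n))" for k
  proof -
    have "(\<lambda>n. N n (r k n) *\<^sub>R e n) = (\<lambda>n. N n (x n) *\<^sub>R e n - N n (truncate k x n) *\<^sub>R e n)"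
      by (auto simp: r_def truncate_def N_0)
    then show ?thesis
      using sums_diff[OF summable_sums[OF sx] truncate_sums[of k x]] by simp
  qed
  have rX: "r k \<in> X" for k
    using sums_summable[OF r_sums[of k]] xV by (auto simp: direct_sum_def r_def V_0)
  have "\<bar>f (truncate k x) - f x\<bar> \<le> norm ((\<Sum>n<k. N n (x n) *\<^sub>R e n) - (\<Sum>n. N n (x n) *\<^sub>R e n))" for k
  proof -
    have "x = truncate k x + r k" by (auto simp: truncate_def r_def)
    then have "f x = f (truncate k x) + f (r k)"
      using dual_ball_add[OF f truncate_in[OF xV] rX, of k k] by simp
    then have "\<bar>f (truncate k x) - f x\<bar> \<le> normX (r k)"
      using dual_ball_le_norm[OF f rX, of k] by simp
    then show ?thesis
      by (simp add: direct_sum_norm_def sums_unique[OF r_sums, symmetric] norm_minus_commute)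
  qed
  moreover have "(\<lambda>k. norm ((\<Sum>n<k. N n (x n) *\<^sub>R e n) - (\<Sum>n. N n (x n) *\<^sub>R e n))) \<longlonglongrightarrow> 0"
    using summable_LIMSEQ[OF sx] by (intro tendsto_norm_zero LIM_zero)
  ultimately have "(\<lambda>k. f (truncate k x) - f x) \<longlonglongrightarrow> 0"
    by (intro Lim_null_comparison[where f = "\<lambda>k. f (truncate k x) - f x"
          and g = "\<lambda>k. norm ((\<Sum>n<k. N n (x n) *\<^sub>R e n) - (\<Sum>n. N n (x n) *\<^sub>R e n))"]
        always_eventually) simp_all
  then show ?thesis by (rule LIM_zero_cancel)
qed

section \<open>Norms of the restrictions to the summands\<close>

definition component_norm :: "((nat \<Rightarrow> 'v) \<Rightarrow> real) \<Rightarrow> nat \<Rightarrow> real"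
  where "component_norm f n = dual_norm (V n) (N n) (\<lambda>v. f (single n v))"

lemma component_norm_upper:
  assumes f: "f \<in> dual_ball X normX" and v: "v \<in> V n" "N n v \<le> 1"
  shows "\<bar>f (single n v)\<bar> \<le> component_norm f n"
  unfolding component_norm_def dual_norm_def
proof (rule cSUP_upper)
  show "bdd_above ((\<lambda>v. \<bar>f (single n v)\<bar>) ` {v \<in> V n. N n v \<le> 1})"
    using dual_ball_le_norm[OF f single_in] norm_single
    by (intro bdd_aboveI2[where M = 1]) fastforce
qed (use v in auto)

lemma component_norm_nonneg: "f \<in> dual_ball X normX \<Longrightarrow> 0 \<le> component_norm f n"
  using component_norm_upper[of f 0 n] V_0 N_0 by (simp add: order_trans[OF abs_ge_zero])

lemma component_norm_least:
  assumes "\<And>v. v \<in> V n \<Longrightarrow> N n v \<le> 1 \<Longrightarrow> \<bar>f (single n v)\<bar> \<le> C"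
  shows "component_norm f n \<le> C"
  unfolding component_norm_def dual_norm_def
proof (rule cSUP_least)
  show "{v \<in> V n. N n v \<le> 1} \<noteq> {}" using V_0[of n] N_0[of n] by (auto intro!: exI[of _ 0])
qed (use assms in auto)

lemma component_norm_bound:
  assumes f: "f \<in> dual_ball X normX" and v: "v \<in> V n"
  shows "\<bar>f (single n v)\<bar> \<le> component_norm f n * N n v"
proof (cases "N n v = 0")
  case True
  then show ?thesis
    using dual_ball_le_norm[OF f single_in[OF v]] norm_single[OF v] by simp
next
  case False
  then have pos: "0 < N n v" using N_nonneg[OF v] by simp
  have "\<bar>f (single n ((1 / N n v) *\<^sub>R v))\<bar> \<le> component_norm f n"
    using v pos by (intro component_norm_upper f) (auto simp: V_scale N_scale)
  then show ?thesis
    using pos by (simp add: single_scaleR dual_ball_scaleR[OF f single_in[OF v]] abs_mult field_simps)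
qed

text \<open>The reverse triangle inequality for the dual norm of the summand.\<close>

lemma component_norm_diff:
  assumes f: "f \<in> dual_ball X normX" and g: "g \<in> dual_ball X normX" and "0 \<le> \<eta>"
    and close: "\<And>v. v \<in> V n \<Longrightarrow> \<bar>g (single n v) - f (single n v)\<bar> \<le> \<eta> * N n v"
  shows "\<bar>component_norm g n - component_norm f n\<bar> \<le> \<eta>"
proof -
  have near: "\<bar>g (single n v) - f (single n v)\<bar> \<le> \<eta>" if "v \<in> V n" "N n v \<le> 1" for v
    using close[OF that(1)] mult_left_le[OF that(2) \<open>0 \<le> \<eta>\<close>] by linarith
  have "component_norm g n \<le> component_norm f n + \<eta>"
  proof (rule component_norm_least)
    fix v assume "v \<in> V n" "N n v \<le> 1"
    then show "\<bar>g (single n v)\<bar> \<le> component_norm f n + \<eta>"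
      using near[of v] component_norm_upper[OF f, of v n] by linarith
  qed
  moreover have "component_norm f n \<le> component_norm g n + \<eta>"
  proof (rule component_norm_least)
    fix v assume "v \<in> V n" "N n v \<le> 1"
    then show "\<bar>f (single n v)\<bar> \<le> component_norm g n + \<eta>"
      using near[of v] component_norm_upper[OF g, of v n] by linarith
  qed
  ultimately show ?thesis by linarith
qed

text \<open>Choose in each summand a vector of the unit ball that almost norms \<open>f\<close>, and
  weight it by \<open>\<bar>c n\<bar>\<close>. By 1-unconditionality the assembled vector has norm
  at most that of the sum of the \<open>c n *\<^sub>R e n\<close>, while \<open>f\<close> on it is
  almost the required sum.\<close>

lemma component_norm_admissible:
  assumes f: "f \<in> dual_ball X normX"
  shows "admissible (component_norm f)"
  unfolding admissible_def
proof (intro allI, rule field_le_epsilon)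
  fix m and c :: "nat \<Rightarrow> real" and \<theta> :: real assume \<theta>: "0 < \<theta>"
  \<comment> \<open>Chosen so that the total loss, \<open>\<tau>\<close> times the sum of the
    \<open>\<bar>c n\<bar>\<close>, is at most \<open>\<theta>\<close>; the summand 1 keeps the
    denominator positive.\<close>
  define \<tau> where "\<tau> = \<theta> / (1 + (\<Sum>n<m. \<bar>c n\<bar>))"
  have S: "0 \<le> (\<Sum>n<m. \<bar>c n\<bar>)" by (simp add: sum_nonneg)
  have \<tau>: "0 < \<tau>" using \<theta> S unfolding \<tau>_def by (intro divide_pos_pos) linarith+
  have "\<exists>u. u \<in> V n \<and> N n u \<le> 1 \<and> component_norm f n - \<tau> \<le> f (single n u)" for n
  proof -
    have "\<not> component_norm f n \<le> component_norm f n - \<tau>" using \<tau> by simp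
    then have "\<exists>v. v \<in> V n \<and> N n v \<le> 1 \<and> \<not> \<bar>f (single n v)\<bar> \<le> component_norm f n - \<tau>"
      using component_norm_least[of n f "component_norm f n - \<tau>"] by blast
    then obtain v where v: "v \<in> V n" "N n v \<le> 1" "component_norm f n - \<tau> < \<bar>f (single n v)\<bar>"
      by auto
    \<comment> \<open>Replacing \<open>v\<close> by its negative if necessary makes \<open>f\<close>
      nonnegative there, so no cancellation occurs between summands.\<close>
    have "f (single n ((-1) *\<^sub>R v)) = - f (single n v)"
      unfolding single_scaleR dual_ball_scaleR[OF f single_in[OF v(1)]] by simp
    moreover have "(-1) *\<^sub>R v \<in> V n" "N n ((-1) *\<^sub>R v) \<le> 1"
      using v V_scale[OF v(1), of "-1"] N_scale[OF v(1), of "-1"] by simp_all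
    ultimately show ?thesis
      using v by (metis abs_if less_imp_le)
  qed
  then obtain u where u: "\<And>n. u n \<in> V n" "\<And>n. N n (u n) \<le> 1"
    "\<And>n. component_norm f n - \<tau> \<le> f (single n (u n))"
    by metis
  define z where "z n = \<bar>c n\<bar> *\<^sub>R u n" for n
  have zV: "z n \<in> V n" for n unfolding z_def by (rule V_scale[OF u(1)])
  have "(\<Sum>n<m. component_norm f n * \<bar>c n\<bar>) - \<tau> * (\<Sum>n<m. \<bar>c n\<bar>)
      = (\<Sum>n<m. (component_norm f n - \<tau>) * \<bar>c n\<bar>)"
    by (simp add: left_diff_distrib sum_subtractf sum_distrib_left)
  also have "\<dots> \<le> (\<Sum>n<m. f (single n (z n)))"
    unfolding z_def single_scaleR dual_ball_scaleR[OF f single_in[OF u(1)]]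
    unfolding mult.commute[of _ "\<bar>c _\<bar>"] using u(3) by (intro sum_mono mult_left_mono) auto
  also have "\<dots> = f (truncate m z)" using dual_ball_truncate[OF f zV] by simp
  also have "\<dots> \<le> normX (truncate m z)"
    using dual_ball_le_norm[OF f truncate_in[OF zV], of m] by simp
  also have "\<dots> \<le> norm (\<Sum>n<m. c n *\<^sub>R e n)"
    unfolding norm_truncate using u N_nonneg[OF u(1)]
    by (intro norm_sum_mono) (simp add: z_def N_scale abs_mult mult_left_le)
  finally have "(\<Sum>n<m. component_norm f n * \<bar>c n\<bar>) \<le> norm (\<Sum>n<m. c n *\<^sub>R e n) + \<tau> * (\<Sum>n<m. \<bar>c n\<bar>)"
    by simp
  moreover have "\<tau> * (\<Sum>n<m. \<bar>c n\<bar>) \<le> \<theta>"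
  proof -
    have "\<tau> * (\<Sum>n<m. \<bar>c n\<bar>) \<le> \<tau> * (1 + (\<Sum>n<m. \<bar>c n\<bar>))"
      using \<tau> by (intro mult_left_mono) auto
    also have "\<dots> = \<theta>"
      using S unfolding \<tau>_def by (intro nonzero_eq_divide_eq[THEN iffD1]) linarith+
    finally show ?thesis .
  qed
  ultimately show "(\<Sum>n<m. \<bar>component_norm f n\<bar> * \<bar>c n\<bar>) \<le> norm (\<Sum>n<m. c n *\<^sub>R e n) + \<theta>"
    using component_norm_nonneg[OF f] by simp
qed

text \<open>This is where finite dimension enters: norm neighbourhoods in each summand of the dual are weak*
  neighbourhoods.\<close>

lemma component_neighbourhood:
  assumes f: "f \<in> dual_ball X normX" and \<eta>: "0 < \<eta>"
  obtains U where "openin (weak_star_topology X normX) U" "f \<in> U"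
    "\<And>g n v. g \<in> U \<Longrightarrow> g \<in> dual_ball X normX \<Longrightarrow> n < m \<Longrightarrow> v \<in> V n \<Longrightarrow>
      \<bar>g (single n v) - f (single n v)\<bar> \<le> \<eta> * N n v"
proof -
  \<comment> \<open>Packaging the coefficient bound as one predicate allows \<open>B\<close> and
    \<open>C\<close> to be chosen for all \<open>n\<close> simultaneously.\<close>
  define P where "P n B C \<longleftrightarrow> finite B \<and> B \<subseteq> V n \<and> 0 < C \<and>
      (\<forall>x\<in>V n. \<exists>u. x = (\<Sum>b\<in>B. u b *\<^sub>R b) \<and> (\<Sum>b\<in>B. \<bar>u b\<bar>) \<le> C * N n x)" for n B C
  have "\<exists>B C. P n B C" for n
    unfolding P_def by (rule finite_dimensional_coefficient_bound[OF normed[of n] findim[of n]]) blast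
  then obtain B C where BC: "\<And>n. P n (B n) (C n)"
    by metis
  then have B: "\<And>n. finite (B n)" "\<And>n. B n \<subseteq> V n" and C: "\<And>n. 0 < C n"
    and expand: "\<And>n x. x \<in> V n \<Longrightarrow> \<exists>u. x = (\<Sum>b\<in>B n. u b *\<^sub>R b) \<and> (\<Sum>b\<in>B n. \<bar>u b\<bar>) \<le> C n * N n x"
    unfolding P_def by blast+
  define I where "I = (SIGMA n:{..<m}. B n)"
  \<comment> \<open>The tolerance \<open>\<eta> / C n\<close> compensates the factor
    \<open>C n\<close> in the bound on the coefficients of \<open>v\<close>.\<close>
  define Nh where "Nh = (\<lambda>(n, b). {g \<in> topspace (weak_star_topology X normX).
    g (single n b) \<in> {f (single n b) - \<eta> / C n <..< f (single n b) + \<eta> / C n}})"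
  \<comment> \<open>Intersecting with the whole space matters when \<open>I\<close> is empty, since
    the empty intersection is the universal set.\<close>
  define U where "U = topspace (weak_star_topology X normX) \<inter> \<Inter>(Nh ` I)"
  have "openin (weak_star_topology X normX) (Nh i)" if "i \<in> I" for i
  proof -
    obtain n b where i: "i = (n, b)" by force
    then have "single n b \<in> X" using that B(2)[of n] by (auto simp: I_def intro: single_in)
    then have "continuous_map (weak_star_topology X normX) euclideanreal (\<lambda>g. g (single n b))"
      unfolding weak_star_topology_def
      by (intro continuous_map_from_subtopology continuous_map_product_projection)
    then show ?thesis
      unfolding i Nh_def prod.case by (rule openin_continuous_map_preimage) simp
  qed
  then have "openin (weak_star_topology X normX) U"
    unfolding U_def using B(1) by (intro openin_Int_Inter) (auto simp: I_def)
  moreover have ftop: "f \<in> topspace (weak_star_topology X normX)"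
    using f by (auto simp: weak_star_topology_def dual_ball_def dual_space_def PiE_def)
  have "f \<in> U"
    using ftop \<eta> C by (auto simp: U_def Nh_def)
  moreover have "\<bar>g (single n v) - f (single n v)\<bar> \<le> \<eta> * N n v"
    if g: "g \<in> U" "g \<in> dual_ball X normX" and n: "n < m" and v: "v \<in> V n" for g n v
  proof -
    have lin: "h (single n (\<Sum>b\<in>A. u b *\<^sub>R b)) = (\<Sum>b\<in>A. u b * h (single n b))"
      if h: "h \<in> dual_ball X normX" and "finite A" "A \<subseteq> V n" for h A u
      using that(2,3)
    proof (induction A)
      case empty
      then show ?case
        using dual_ball_le_norm[OF h single_in[OF V_0[of n]]] norm_single[OF V_0[of n]] by (simp add: N_0)
    next
      case (insert b A)
      have *: "single n b \<in> X" "single n (u b *\<^sub>R b) \<in> X" "single n (\<Sum>b\<in>A. u b *\<^sub>R b) \<in> X"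
        using insert.prems by (auto intro!: single_in V_scale V_sum)
      have "single n (\<Sum>b\<in>insert b A. u b *\<^sub>R b) = single n (u b *\<^sub>R b) + single n (\<Sum>b\<in>A. u b *\<^sub>R b)"
        using insert.hyps by (simp only: sum.insert[OF insert.hyps] single_add)
      then have "h (single n (\<Sum>b\<in>insert b A. u b *\<^sub>R b)) =
          h (single n (u b *\<^sub>R b)) + h (single n (\<Sum>b\<in>A. u b *\<^sub>R b))"
        using dual_ball_add[OF h *(2,3)] by metis
      then show ?case
        using insert unfolding single_scaleR dual_ball_scaleR[OF h *(1)] by simp
    qed
    obtain u where u: "v = (\<Sum>b\<in>B n. u b *\<^sub>R b)" "(\<Sum>b\<in>B n. \<bar>u b\<bar>) \<le> C n * N n v"
      using expand[OF v] by blast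
    have near: "\<bar>g (single n b) - f (single n b)\<bar> \<le> \<eta> / C n" if "b \<in> B n" for b
    proof -
      have "(n, b) \<in> I" using that n by (simp add: I_def)
      then have "g \<in> Nh (n, b)" using g(1) by (auto simp: U_def)
      then show ?thesis by (simp add: Nh_def abs_le_iff)
    qed
    have "g (single n v) - f (single n v) = (\<Sum>b\<in>B n. u b * (g (single n b) - f (single n b)))"
      unfolding u(1) lin[OF g(2) B(1) B(2)] lin[OF f B(1) B(2)]
      by (simp add: right_diff_distrib sum_subtractf)
    also have "\<bar>\<dots>\<bar> \<le> (\<Sum>b\<in>B n. \<bar>u b\<bar> * (\<eta> / C n))"
      by (rule sum_abs[THEN order_trans], rule sum_mono, unfold abs_mult)
        (rule mult_left_mono[OF near abs_ge_zero])
    also have "\<dots> = (\<Sum>b\<in>B n. \<bar>u b\<bar>) * (\<eta> / C n)" by (rule sum_distrib_right[symmetric])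
    also have "\<dots> \<le> (C n * N n v) * (\<eta> / C n)"
      using u(2) \<eta> C[of n] by (intro mult_right_mono) auto
    also have "\<dots> = \<eta> * N n v" using C[of n] by simp
    finally show ?thesis .
  qed
  ultimately show thesis by (rule that)
qed

text \<open>If \<open>g\<close> is weak* close but \<open>\<epsilon>/2\<close>-far from \<open>f\<close>, the distance is carried by a tail on which the
  component norms of \<open>f\<close> are negligible, so it persists for the component norms.\<close>

lemma szlenk_derivative_component_norm:
  assumes sz: "summable_szlenk (UNIV :: 'e set) norm" and \<epsilon>: "0 < \<epsilon>"
    and K: "K \<subseteq> dual_ball X normX" and L: "L \<subseteq> dual_ball UNIV norm"
    and KL: "\<And>g. g \<in> K \<Longrightarrow> functional (component_norm g) \<in> L"
    and fK: "f \<in> szlenk_derivative X normX \<epsilon> K"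
  shows "functional (component_norm f) \<in> szlenk_derivative UNIV norm (\<epsilon> / 3) L"
proof (rule szlenk_derivativeI[OF L])
  have "f \<in> K" using fK by (simp add: szlenk_derivative_def)
  then have f: "f \<in> dual_ball X normX" and fL: "functional (component_norm f) \<in> L"
    using K KL by auto
  show "functional (component_norm f) \<in> L" by (rule fL)
  fix m0 and \<eta>0 :: real assume "0 < \<eta>0"
  \<comment> \<open>Error budget: the coordinates below \<open>m\<close> cost at most
    \<open>\<epsilon> / 24\<close> and the tail of \<open>f\<close>, counted twice, at most
    \<open>\<epsilon> / 12\<close>. From \<open>\<epsilon> / 2\<close> this leaves
    \<open>3 * \<epsilon> / 8\<close>, which exceeds \<open>\<epsilon> / 3\<close>.\<close>
  obtain m1 where m1: "\<And>k c. (\<Sum>n=m1..<k. \<bar>component_norm f n\<bar> * \<bar>c n\<bar>) \<le> \<epsilon> / 24 * norm (\<Sum>n<k. c n *\<^sub>R e n)"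
    using admissible_tail[OF sz component_norm_admissible[OF f], of "\<epsilon> / 24"] \<epsilon> by auto
  define m where "m = max m0 m1"
  \<comment> \<open>The first bound gives the required closeness of coefficients, the second keeps
    the sum of \<open>m\<close> errors below \<open>\<epsilon> / 24\<close>.\<close>
  define \<eta> where "\<eta> = min \<eta>0 (\<epsilon> / (24 * (real m + 1)))"
  have \<eta>: "0 < \<eta>" using \<open>0 < \<eta>0\<close> \<epsilon> by (simp add: \<eta>_def)
  have "real m * \<eta> \<le> real m * (\<epsilon> / (24 * (real m + 1)))"
    by (intro mult_left_mono) (auto simp: \<eta>_def)
  also have "\<dots> \<le> \<epsilon> / 24" using \<epsilon> by (simp add: field_simps)
  finally have m\<eta>: "real m * \<eta> \<le> \<epsilon> / 24" .
  obtain U where U: "openin (weak_star_topology X normX) U" "f \<in> U"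
    and U_near: "\<And>g n v. g \<in> U \<Longrightarrow> g \<in> dual_ball X normX \<Longrightarrow> n < m \<Longrightarrow> v \<in> V n \<Longrightarrow>
      \<bar>g (single n v) - f (single n v)\<bar> \<le> \<eta> * N n v"
    using component_neighbourhood[OF f \<eta>] by blast
  have "\<exists>x\<in>X. normX x \<le> 1"
    using single_in[OF V_0] norm_single[OF V_0] N_0 by (metis zero_le_one)
  then obtain g x where g: "g \<in> K \<inter> U" and x: "x \<in> X" "normX x \<le> 1" and far: "\<epsilon> / 2 < \<bar>g x - f x\<bar>"
    using szlenk_derivative_far_point[OF fK less_imp_le[OF \<epsilon>] U] by metis
  have gball: "g \<in> dual_ball X normX" using g K by auto
  have near: "\<bar>g (single n v) - f (single n v)\<bar> \<le> \<eta> * N n v" if "n < m" "v \<in> V n" for n v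
    using U_near gball g that by blast
  have xV: "\<And>n. x n \<in> V n" and sx: "summable (\<lambda>n. N n (x n) *\<^sub>R e n)"
    using x(1) by (auto simp: direct_sum_def)
  have partial: "norm (\<Sum>n<k. N n (x n) *\<^sub>R e n) \<le> 1" for k
    using norm_sum_le_suminf[OF sx, of k] x(2) by (simp add: direct_sum_norm_def)
  have Nx: "N n (x n) \<le> 1" for n
  proof -
    have "norm (\<Sum>i<Suc n. (if i = n then N n (x n) else 0) *\<^sub>R e i) \<le> norm (\<Sum>i<Suc n. N i (x i) *\<^sub>R e i)"
      by (intro norm_sum_mono) auto
    also have "(\<Sum>i<Suc n. (if i = n then N n (x n) else 0) *\<^sub>R e i) = N n (x n) *\<^sub>R e n"
      by (simp add: sum.neutral)
    finally show ?thesis using partial[of "Suc n"] N_nonneg[OF xV] by (simp add: norm_e)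
  qed
  \<comment> \<open>Strictness of the inequality at \<open>x\<close> lets it pass to a long
    truncation, so that only finite sums have to be estimated.\<close>
  have "(\<lambda>k. \<bar>g (truncate k x) - f (truncate k x)\<bar>) \<longlonglongrightarrow> \<bar>g x - f x\<bar>"
    by (intro tendsto_intros dual_ball_truncate_tendsto f gball x)
  then have "\<forall>\<^sub>F k in sequentially. \<epsilon> / 2 < \<bar>g (truncate k x) - f (truncate k x)\<bar>"
    using far by (rule order_tendstoD)
  then obtain k where k: "m \<le> k" and fark: "\<epsilon> / 2 < \<bar>g (truncate k x) - f (truncate k x)\<bar>"
    by (metis (mono_tags, lifting) eventually_sequentially nle_le)
  \<comment> \<open>The tail of the norms of the blocks of \<open>x\<close>; the corresponding
    \<open>y\<close> in \<open>E\<close> is the vector that separates the two image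
    functionals.\<close>
  define c where "c n = (if m \<le> n then N n (x n) else 0)" for n
  define y where "y = (\<Sum>n<k. c n *\<^sub>R e n)"
  have "norm y \<le> norm (\<Sum>n<k. N n (x n) *\<^sub>R e n)"
    unfolding y_def by (intro norm_sum_mono) (simp add: c_def)
  then have y: "norm y \<le> 1" using partial[of k] by linarith
  define a where "a = component_norm f"
  define b where "b = component_norm g"
  have split: "(\<Sum>n<k. t n) = (\<Sum>n<m. t n) + (\<Sum>n=m..<k. t n)" for t :: "nat \<Rightarrow> real"
    using sum.atLeastLessThan_concat[of 0 m k t] k by (simp add: lessThan_atLeast0)
  have "\<epsilon> / 2 < \<bar>\<Sum>n<k. g (single n (x n)) - f (single n (x n))\<bar>"
    using fark by (simp add: dual_ball_truncate[OF f xV] dual_ball_truncate[OF gball xV] sum_subtractf)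
  also have "\<dots> \<le> (\<Sum>n<k. \<bar>g (single n (x n)) - f (single n (x n))\<bar>)" by (rule sum_abs)
  also have "\<dots> \<le> (\<Sum>n<m. \<eta>) + (\<Sum>n=m..<k. (b n + a n) * N n (x n))"
    unfolding split
  proof (intro add_mono sum_mono)
    fix n assume "n \<in> {..<m}"
    then have "\<bar>g (single n (x n)) - f (single n (x n))\<bar> \<le> \<eta> * N n (x n)" using near xV by auto
    also have "\<dots> \<le> \<eta>" using Nx \<eta> by (simp add: mult_left_le)
    finally show "\<bar>g (single n (x n)) - f (single n (x n))\<bar> \<le> \<eta>" .
  next
    fix n
    show "\<bar>g (single n (x n)) - f (single n (x n))\<bar> \<le> (b n + a n) * N n (x n)"
      unfolding distrib_right a_def b_def
      using component_norm_bound[OF f xV[of n]] component_norm_bound[OF gball xV[of n]] by linarith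
  qed
  \<comment> \<open>On the tail \<open>b + a = (b - a) + 2 * a\<close>: the first term is the
    difference of the image functionals at \<open>y\<close>, the second is small by the choice of
    \<open>m1\<close>.\<close>
  also have "\<dots> = real m * \<eta> + (\<Sum>n=m..<k. (b n - a n) * N n (x n)) + 2 * (\<Sum>n=m..<k. a n * N n (x n))"
    by (simp add: sum_distrib_left sum.distrib[symmetric] algebra_simps)
  also have "(\<Sum>n=m..<k. (b n - a n) * N n (x n)) = functional b y - functional a y"
    unfolding y_def functional_sum sum_subtractf[symmetric] left_diff_distrib[symmetric]
    by (rule sum.mono_neutral_cong_left) (auto simp: c_def)
  also have "(\<Sum>n=m..<k. a n * N n (x n)) \<le> \<epsilon> / 24"
  proof -
    have "(\<Sum>n=m..<k. a n * N n (x n)) = (\<Sum>n=m1..<k. \<bar>a n\<bar> * \<bar>c n\<bar>)"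
      using component_norm_nonneg[OF f] N_nonneg[OF xV]
      by (intro sum.mono_neutral_cong_left) (auto simp: m_def c_def a_def)
    also have "\<dots> \<le> \<epsilon> / 24 * norm y" unfolding a_def y_def by (rule m1)
    also have "\<dots> \<le> \<epsilon> / 24" using y \<epsilon> by (simp add: mult_left_le)
    finally show ?thesis .
  qed
  finally have "\<epsilon> / 3 < \<bar>functional b y - functional a y\<bar>"
    using m\<eta> \<epsilon> by simp
  moreover have "\<bar>functional b (e n) - functional a (e n)\<bar> \<le> \<eta>0" if "n < m0" for n
  proof -
    have "n < m" using that by (simp add: m_def)
    then have "\<bar>b n - a n\<bar> \<le> \<eta>"
      unfolding a_def b_def using near \<eta> by (intro component_norm_diff f gball) auto
    then show ?thesis by (simp add: functional_basis \<eta>_def)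
  qed
  moreover have "functional b \<in> L" using KL g by (simp add: b_def)
  ultimately show "\<exists>\<psi>\<in>L. \<exists>\<theta>\<in>L. \<exists>y.
      (\<forall>n<m0. \<bar>\<psi> (e n) - functional (component_norm f) (e n)\<bar> \<le> \<eta>0) \<and>
      (\<forall>n<m0. \<bar>\<theta> (e n) - functional (component_norm f) (e n)\<bar> \<le> \<eta>0) \<and>
      norm y \<le> 1 \<and> \<epsilon> / 3 < \<bar>\<psi> y - \<theta> y\<bar>"
    \<comment> \<open>The second witness is the image of \<open>f\<close> itself, whose closeness to
      the base point is trivial.\<close>
    using y fL \<open>0 < \<eta>0\<close> unfolding a_def[symmetric]
    by (intro bexI[of _ "functional b"] bexI[of _ "functional a"] exI[of _ y]) auto
qed

section \<open>Iteration and the final constant\<close>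

text \<open>The head of the list is the outermost derivative, so induction peels it off. The
  statement is generalised over \<open>f\<close> because the one-step result needs the inclusion for
  every element of the inner derivative.\<close>

lemma iterated_szlenk_derivative_component_norm:
  assumes sz: "summable_szlenk (UNIV :: 'e set) norm" and "\<forall>\<epsilon>\<in>set \<epsilon>s. 0 < \<epsilon>"
    and "f \<in> foldr (szlenk_derivative X normX) \<epsilon>s (dual_ball X normX)"
  shows "functional (component_norm f) \<in>
    foldr (szlenk_derivative UNIV norm) (map (\<lambda>\<epsilon>. \<epsilon> / 3) \<epsilon>s) (dual_ball UNIV norm)"
  using assms(2,3)
proof (induction \<epsilon>s arbitrary: f)
  case Nil
  then show ?case by (simp add: functional_dual_ball component_norm_admissible)
next
  case (Cons \<epsilon> \<epsilon>s)
  show ?case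
    unfolding list.map foldr_Cons comp_apply
  proof (rule szlenk_derivative_component_norm[OF sz])
    show "f \<in> szlenk_derivative X normX \<epsilon> (foldr (szlenk_derivative X normX) \<epsilon>s (dual_ball X normX))"
      using Cons.prems by simp
  qed (use Cons foldr_szlenk_derivative_subset in \<open>simp_all\<close>)
qed

lemma summable_szlenk_direct_sum:
  assumes sz: "summable_szlenk (UNIV :: 'e set) norm"
  shows "summable_szlenk X normX"
proof -
  obtain M where M: "\<And>\<epsilon>s. (\<forall>\<epsilon>\<in>set \<epsilon>s. 0 < \<epsilon>) \<Longrightarrow>
      foldr (szlenk_derivative UNIV norm) \<epsilon>s (dual_ball (UNIV :: 'e set) norm) \<noteq> {} \<Longrightarrow> sum_list \<epsilon>s \<le> M"
    using sz unfolding summable_szlenk_def by blast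
  have "sum_list \<epsilon>s \<le> 3 * M"
    if pos: "\<forall>\<epsilon>\<in>set \<epsilon>s. 0 < \<epsilon>" and ne: "foldr (szlenk_derivative X normX) \<epsilon>s (dual_ball X normX) \<noteq> {}" for \<epsilon>s
  proof -
    \<comment> \<open>An \<open>f\<close> surviving the derivatives in \<open>X\<close> has an image
      surviving those with all entries divided by 3, to which the bound for \<open>E\<close>
      applies.\<close>
    have "sum_list (map (\<lambda>\<epsilon>. \<epsilon> / 3) \<epsilon>s) \<le> M"
      using iterated_szlenk_derivative_component_norm[OF sz pos] ne pos by (intro M) auto
    then show ?thesis using sum_list_mult_const[of id "1 / 3" \<epsilon>s] by simp
  qed
  then show ?thesis unfolding summable_szlenk_def by blast
qed

end

theorem theorem4p3:
  fixes e :: "nat \<Rightarrow> 'e::banach"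
    and V :: "nat \<Rightarrow> 'v::real_vector set"
    and N :: "nat \<Rightarrow> 'v \<Rightarrow> real"
  assumes "unconditional_basis 1 e"
    and "\<And>n. norm (e n) = 1"
    and "summable_szlenk (UNIV :: 'e set) norm"
    and "\<And>n. banach_space_on (V n) (N n)"
    and "\<And>n. finite_dimensional (V n)"
  shows "summable_szlenk (direct_sum e V N) (direct_sum_norm e N)"
proof -
  interpret finite_dimensional_direct_sum e V N
    using assms by unfold_locales (auto simp: banach_space_on_def)
  show ?thesis using assms(3) by (rule summable_szlenk_direct_sum)
qed

end
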